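(* For $n\geq 1$ let $$t_n(x)=\begin{cases}(1+x)(1-x^2)^{k-1}, & n=2k-1,\\ -(1-x^2)^k, & n=2k.\end{cases}$$ Then for every $n\geq 1$, $T_n(x)$ equals the lower Hessenberg determinant of order $n$ $$T_n(x)=\det(m_{i,j})_{1\leq i,j\leq n},$$ where $m_{i,1}=\frac{x}{1+x}t_i(x)$ for $1\leq i\leq n$ (so $m_{1,1}=x$, $m_{2,1}=-x(1-x)$), $m_{i,j}=\binom{i}{j-1}t_{i-j+1}(x)$ for $2\leq j\leq i\leq n$, $m_{i,i+1}=-1$ for $1\leq i\leq n-1$, and $m_{i,j}=0$ for $j>i+1$.
   Context: A signed permutation $\pi$ in the hyperoctahedral group $\mathcal{B}_n$ is a bijection of $\{\pm1,\ldots,\pm n\}$ with $\pi(-i)=-\pi(i)$, identified with the word $\pi(0)\pi(1)\cdots\pi(n)$, where $\pi(0)=0$. An alternating run of $\pi$ is a maximal consecutive subword (of length at least two) of $\pi(0)\pi(1)\cdots\pi(n)$ that is monotonic in the usual order of integers. $\pi$ is an up signed permutation if $\pi(1)>0$. $T(n,k)$ is the number of up signed permutations in $\mathcal{B}_n$ with exactly $k$ alternating runs, and $T_n(x)=\sum_{k=1}^nT(n,k)x^k$ (type $B$ alternating run polynomials over up signed permutations). E.g. $T_1=x$, $T_2=x+3x^2$, $T_3=x+12x^2+11x^3$. It is known (Zhao) that $T(n,k)=(2k-1)T(n-1,k)+3T(n-1,k-1)+(2n-2k+2)T(n-1,k-2)$ for $n\geq 2$, $1\leq k\leq n$. *)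

theory Defs
  imports
    "HOL-Computational_Algebra.Polynomial"
    "HOL-Combinatorics.Permutations"
    "Jordan_Normal_Form.Determinant"
begin

(* "permutes" makes a signed permutation the identity outside {-n..n} - {0}, so every element of
   the hyperoctahedral group is represented by exactly one function, and it satisfies \<pi> 0 = 0. *)

definition signed_perms :: "nat \<Rightarrow> (int \<Rightarrow> int) set" where
  "signed_perms n = {\<pi>. \<pi> permutes ({- int n..int n} - {0}) \<and> (\<forall>i. \<pi> (- i) = - \<pi> i)}"

definition up_signed_perms :: "nat \<Rightarrow> (int \<Rightarrow> int) set" where
  "up_signed_perms n = {\<pi> \<in> signed_perms n. \<pi> 1 > 0}"

definition monotonic_subword :: "(int \<Rightarrow> int) \<Rightarrow> int \<Rightarrow> int \<Rightarrow> bool" where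
  "monotonic_subword \<pi> a b \<longleftrightarrow> mono_on {a..b} \<pi> \<or> antimono_on {a..b} \<pi>"

(* A run is represented by the pair (a, b) of the positions of its first and last letter in the
   word \<pi>(0) \<pi>(1) ... \<pi>(n). *)

definition alternating_runs :: "nat \<Rightarrow> (int \<Rightarrow> int) \<Rightarrow> (int \<times> int) set" where
  "alternating_runs n \<pi> =
     {(a, b). 0 \<le> a \<and> a < b \<and> b \<le> int n \<and> monotonic_subword \<pi> a b \<and>
        (\<forall>c d. 0 \<le> c \<and> c \<le> a \<and> b \<le> d \<and> d \<le> int n \<and> monotonic_subword \<pi> c d
           \<longrightarrow> c = a \<and> d = b)}"

definition T :: "nat \<Rightarrow> nat \<Rightarrow> nat" where
  "T n k = card {\<pi> \<in> up_signed_perms n. card (alternating_runs n \<pi>) = k}"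

definition X :: "int poly" where
  "X = [:0, 1:]"

definition T_poly :: "nat \<Rightarrow> int poly" where
  "T_poly n = (\<Sum>k = 1..n. of_nat (T n k) * X ^ k)"

definition t_poly :: "nat \<Rightarrow> int poly" where
  "t_poly n =
     (if odd n then (1 + X) * (1 - X ^ 2) ^ ((n + 1) div 2 - 1)
      else - ((1 - X ^ 2) ^ (n div 2)))"

lemma t_poly_odd: "k \<ge> 1 \<Longrightarrow> t_poly (2 * k - 1) = (1 + X) * (1 - X ^ 2) ^ (k - 1)"
  by (simp add: t_poly_def)

lemma t_poly_even: "t_poly (2 * k) = - ((1 - X ^ 2) ^ k)"
  by (simp add: t_poly_def)

(* The indices i, j are 1-based. The division in the first column is exact, see
   entry_first_column. *)

definition entry :: "nat \<Rightarrow> nat \<Rightarrow> int poly" where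
  "entry i j =
     (if j = 1 then (X * t_poly i) div (1 + X)
      else if j \<le> i then of_nat (i choose (j - 1)) * t_poly (i - j + 1)
      else if j = i + 1 then - 1
      else 0)"

lemma one_plus_X_dvd_t_poly:
  assumes "n \<ge> 1"
  shows "1 + X dvd t_poly n"
proof (cases "odd n")
  case True
  then show ?thesis by (simp add: t_poly_def)
next
  case False
  with assms have "n div 2 > 0" by presburger
  moreover have "1 - X ^ 2 = (1 + X) * (1 - X)"
    by (simp add: algebra_simps power2_eq_square)
  then have "1 + X dvd 1 - X ^ 2" by simp
  ultimately have "1 + X dvd (1 - X ^ 2) ^ (n div 2)"
    by (meson dvd_power dvd_trans)
  with False show ?thesis by (simp add: t_poly_def)
qed

lemma entry_first_column:
  assumes "i \<ge> 1"
  shows "(1 + X) * entry i 1 = X * t_poly i"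
  using one_plus_X_dvd_t_poly[OF assms] by (simp add: entry_def)

definition hessenberg_mat :: "nat \<Rightarrow> int poly mat" where
  "hessenberg_mat n = mat n n (\<lambda>(r, c). entry (r + 1) (c + 1))"

end

theory Submission
  imports Defs
begin

text \<open>
  Put \<open>F\<^sub>0 = X\<close> and \<open>F\<^sub>k = (1 + X) T\<^sub>k\<close> for \<open>k \<ge> 1\<close>, and extend the closed form of \<open>t\<close> to
  \<open>t\<^sub>0 = - 1\<close>. Expanding a lower Hessenberg determinant with superdiagonal \<open>- 1\<close> gives a linear
  recurrence, and after multiplication by \<open>1 + X\<close> the claim becomes the convolution identity
  \<open>S\<^sub>n = (\<Sum>k\<le>n. (n choose k) t\<^bsub>n-k\<^esub> F\<^sub>k) = 0\<close> for \<open>n \<ge> 1\<close>; in terms of exponential generating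
  functions, \<open>t(z) F(z)\<close> is constant.

  Two recurrences in the index yield this identity. The first one is combinatorial: deleting the
  letter of largest absolute value from a signed permutation gives
  \<open>T\<^bsub>n+1\<^esub> = 2 X (1 - X\<^sup>2) T\<^sub>n' + (3 X - 1 + 2 n X\<^sup>2) T\<^sub>n\<close>, which is Zhao's recurrence for the
  coefficients (lemmas \<open>sum_runs_insertions\<close> and \<open>word_poly_Suc\<close>). The second one is the evident
  relation of \<open>t\<^bsub>n+1\<^esub>\<close> to \<open>t\<^sub>n\<close>, together with the fact that the operator
  \<open>L\<^sub>n f = 2 X (1 - X\<^sup>2) f' + 2 n X\<^sup>2 f\<close> maps \<open>t\<^sub>n\<close> to \<open>0\<close> for even \<open>n\<close> and to \<open>2 X t\<^sub>n\<close> for odd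
  \<open>n\<close>. These operators satisfy the Leibniz rule \<open>L\<^bsub>m+n\<^esub>(f g) = L\<^sub>m f g + f L\<^sub>n g\<close>, so the two
  recurrences combine to \<open>S\<^bsub>n+1\<^esub> = L\<^sub>n S\<^sub>n + (2 X\<^sup>2 - 2) S\<^sub>n\<close>, in which the parity terms cancel.
  Since \<open>S\<^sub>1 = 0\<close>, all later \<open>S\<^sub>n\<close> vanish (lemma \<open>convolution_eq_zero\<close>).

  For the combinatorial part it is convenient to work with words, and with all signed words rather
  than only those that begin with a positive letter: negating all letters preserves the number of
  runs, so this only doubles every count, and the insertion of a new letter needs no side
  condition.
\<close>

section \<open>Runs of a word and the insertion of an extreme letter\<close>

text \<open>
  For at least two letters, the number of alternating runs is one plus the number of turning
  points; this recursion counts the latter, assuming that adjacent letters differ.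
\<close>

fun runs :: "int list \<Rightarrow> nat" where
  "runs (a # b # c # u) = of_bool ((a < b) \<noteq> (b < c)) + runs (b # c # u)"
| "runs [a, b] = 1"
| "runs _ = 0"

lemma runs_map_uminus: "distinct w \<Longrightarrow> runs (map uminus w) = runs w"
  by (induction w rule: runs.induct) auto

text \<open>
  An extreme letter in a gap replaces the step there by a peak or a valley. Encode the steps as
  signs and let there be \<open>k\<close> blocks of equal signs. Replacing a plus by plus-minus or by minus-plus
  adds two runs in general; it adds none if this only lengthens the neighbouring block, that is,
  for plus-minus at the end of a block other than the last one and for minus-plus at the start of
  a block other than the first one (and symmetrically for a minus). At the two ends of the word
  this neighbour is missing and one run is added. Appending a letter at the end adds zero or one
  run. Altogether \<open>2 k - 1\<close> insertions add no run and three add one run.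

  In the induction, only the two insertions into the first gap and the two into the second gap
  of \<open>a # b # c # u\<close> behave differently from the insertions into \<open>b # c # u\<close>.
\<close>

lemma sum_runs_insertions:
  fixes x :: "'a :: comm_ring_1"
  assumes "\<forall>c \<in> set (a # b # u). \<bar>c\<bar> < M" and "distinct (a # b # u)"
  shows "(\<Sum>i\<le>length (b # u). x ^ runs (a # take i (b # u) @ M # drop i (b # u))
             + x ^ runs (a # take i (b # u) @ (- M) # drop i (b # u)))
       = (let k = runs (a # b # u) in (2 * of_nat k - 1) * x ^ k + 3 * x ^ (k + 1)
             + 2 * (of_nat (length (b # u)) - of_nat k) * x ^ (k + 2))"
  using assms
proof (induction u arbitrary: a b)
  case Nil
  then show ?case by (auto simp: Let_def power2_eq_square algebra_simps power3_eq_cube not_less)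
next
  case (Cons c u)
  define P where "P a l r = x ^ runs (a # l @ M # r) + x ^ runs (a # l @ (- M) # r)" for a l r
  define d :: nat where "d = of_bool ((a < b) \<noteq> (b < c))"
  define J where "J = (\<Sum>i\<le>length u. P b (c # take i u) (drop i u))"
  define k where "k = runs (b # c # u)"
  have k': "runs (a # b # c # u) = d + k" by (simp add: d_def k_def)
  have shift: "P a (b # c # l) r = x ^ d * P b (c # l) r" for l r
    by (simp add: P_def d_def power_add algebra_simps)
  have IH: "P b [] (c # u) + J = (2 * of_nat k - 1) * x ^ k + 3 * x ^ (k + 1)
       + 2 * (of_nat (length (c # u)) - of_nat k) * x ^ (k + 2)"
    using Cons.IH[of b c] Cons.prems
    by (simp add: P_def J_def k_def Let_def sum.atMost_Suc_shift del: sum.atMost_Suc runs.simps)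
  have "(\<Sum>i\<le>length (b # c # u). x ^ runs (a # take i (b # c # u) @ M # drop i (b # c # u))
             + x ^ runs (a # take i (b # c # u) @ (- M) # drop i (b # c # u)))
      = P a [] (b # c # u) + P a [b] (c # u) + (\<Sum>i\<le>length u. P a (b # c # take i u) (drop i u))"
    by (simp add: P_def sum.atMost_Suc_shift add_ac del: sum.atMost_Suc runs.simps)
  also have "\<dots> = P a [] (b # c # u) + P a [b] (c # u) + x ^ d * J"
    by (simp add: J_def shift sum_distrib_left)
  also have "\<dots> = (P a [] (b # c # u) + P a [b] (c # u) - x ^ d * P b [] (c # u))
      + x ^ d * (P b [] (c # u) + J)"
    by (simp add: algebra_simps)
  also have "P a [] (b # c # u) + P a [b] (c # u) - x ^ d * P b [] (c # u)
      = (if d = 0 then 2 * x ^ (k + 2) else 2 * x ^ (k + 1))"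
  proof -
    have ineq: "a < M" "b < M" "c < M" "- M < a" "- M < b" "- M < c" "a \<noteq> b" "b \<noteq> c"
      using Cons.prems by auto
    \<comment> \<open>Since M and - M are extreme, one of p and q equals k, according to the direction of the step from b to c.\<close>
    define p q where "p = runs (M # c # u)" and "q = runs ((- M) # c # u)"
    have kpq: "k = (if b < c then q else p)"
      using ineq by (cases u) (auto simp: k_def p_def q_def)
    have first: "P a [] (b # c # u) = x ^ (k + 1) + x ^ (k + 2)"
      using ineq by (cases "b < c") (simp_all add: P_def k_def not_less)
    have tail: "P b [] (c # u) = x ^ (p + 1) + x ^ (q + 1)"
      using ineq by (simp add: P_def p_def q_def not_less)
    have second: "P a [b] (c # u) = x ^ (of_bool (b < a) + p + 1) + x ^ (of_bool (a < b) + q + 1)"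
      using ineq by (simp add: P_def p_def q_def not_less)
    show ?thesis
      unfolding first tail second d_def
      using ineq kpq by (cases "a < b"; cases "b < c") (simp_all add: algebra_simps)
  qed
  also have "(if d = 0 then 2 * x ^ (k + 2) else 2 * x ^ (k + 1)) + x ^ d * (P b [] (c # u) + J)
      = (let k = runs (a # b # c # u) in (2 * of_nat k - 1) * x ^ k + 3 * x ^ (k + 1)
             + 2 * (of_nat (length (b # c # u)) - of_nat k) * x ^ (k + 2))"
    unfolding IH k' Let_def d_def by (simp add: algebra_simps)
  finally show ?case .
qed

section \<open>Signed words\<close>

definition signed_words :: "nat \<Rightarrow> int list set" where
  "signed_words n = {w. length w = n \<and> distinct (map abs w) \<and> abs ` set w = {1..int n}}"

lemma finite_signed_words: "finite (signed_words n)"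
proof (rule finite_subset)
  show "signed_words n \<subseteq> {w. set w \<subseteq> {- int n..int n} \<and> length w = n}"
  proof (clarsimp simp: signed_words_def)
    fix w :: "int list" and y assume "abs ` set w = {1..int (length w)}" "y \<in> set w"
    then have "\<bar>y\<bar> \<in> {1..int (length w)}" by blast
    then show "- int (length w) \<le> y \<and> y \<le> int (length w)" by auto
  qed
qed (simp add: finite_lists_length_eq)

lemma distinct_Cons_0_signed_word:
  assumes "w \<in> signed_words n" shows "distinct (0 # w)"
proof -
  have "0 \<notin> abs ` set w" and "distinct (map abs w)"
    using assms by (simp_all add: signed_words_def)
  then show ?thesis by (auto simp: distinct_map)
qed

text \<open>
  The letter \<open>\<plusminus>N\<close> can be recovered together with its position because all other letters have a
  smaller absolute value.
\<close>

lemma bij_betw_insert_largest: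
  fixes n :: nat
  defines "N \<equiv> int (Suc n)"
  shows "bij_betw (\<lambda>(w, i, e). take i w @ e # drop i w)
           (signed_words n \<times> {..n} \<times> {N, - N}) (signed_words (Suc n))"
proof (rule bij_betw_imageI)
  let ?f = "\<lambda>(w :: int list, i, e). take i w @ e # drop i w"
  let ?D = "signed_words n \<times> {..n} \<times> {N, - N}"
  let ?P = "\<lambda>a. \<bar>a\<bar> \<noteq> N"
  have small: "?P a" if "w \<in> signed_words n" "a \<in> set w" for w a
  proof -
    have "\<bar>a\<bar> \<in> {1..int n}" using that unfolding signed_words_def by blast
    then show ?thesis by (simp add: N_def)
  qed
  have absN: "\<bar>e\<bar> = N" if "e \<in> {N, - N}" for e using that by (auto simp: N_def)
  show "inj_on ?f ?D"
  proof (rule inj_on_inverseI)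
    fix p assume "p \<in> ?D"
    then obtain w i e where p: "p = (w, i, e)" and w: "w \<in> signed_words n" and i: "i \<in> {..n}"
      and e: "e \<in> {N, - N}" by auto
    let ?v = "take i w @ e # drop i w"
    have pre: "\<forall>a \<in> set (take i w). ?P a" and suf: "\<forall>a \<in> set (drop i w). ?P a"
      using small[OF w] by (auto dest: in_set_takeD in_set_dropD)
    have "filter ?P ?v = w" using pre suf absN[OF e] by (simp add: filter_id_conv[THEN iffD2])
    moreover have "takeWhile ?P ?v = take i w" using pre absN[OF e] by simp
    moreover have "filter (\<lambda>a. \<not> ?P a) ?v = [e]" using pre suf absN[OF e] by simp
    moreover have "i \<le> length w" using w i by (simp add: signed_words_def)
    \<comment> \<open>The inverse deletes the letter of absolute value N and reads off its position and sign.\<close>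
    ultimately show "(\<lambda>v. (filter ?P v, length (takeWhile ?P v), hd (filter (\<lambda>a. \<not> ?P a) v)))
        (?f p) = p"
      unfolding p by simp
  qed
  show "?f ` ?D = signed_words (Suc n)"
  proof (intro equalityI subsetI)
    fix v assume "v \<in> ?f ` ?D"
    then obtain w i e where v: "v = take i w @ e # drop i w" and w: "w \<in> signed_words n"
      and i: "i \<le> n" and e: "e \<in> {N, - N}" by auto
    define l r where "l = take i w" and "r = drop i w"
    have lr: "distinct (map abs (l @ r))" "abs ` set (l @ r) = {1..int n}"
      using w by (simp_all only: l_def r_def append_take_drop_id signed_words_def mem_Collect_eq)
    moreover from lr(2) have "N \<notin> abs ` set (l @ r)" by (simp only: N_def) simp
    ultimately have "distinct (map abs v)" "abs ` set v = insert N {1..int n}"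
      unfolding v l_def[symmetric] r_def[symmetric] using absN[OF e] by auto
    moreover have "insert N {1..int n} = {1..int (Suc n)}" by (auto simp: N_def)
    ultimately show "v \<in> signed_words (Suc n)"
      using w i by (simp add: signed_words_def v)
  next
    fix v assume v: "v \<in> signed_words (Suc n)"
    then have "N \<in> abs ` set v" by (simp add: signed_words_def N_def)
    then obtain e where e: "e \<in> set v" "\<bar>e\<bar> = N" by auto
    then obtain us vs where split: "v = us @ e # vs" by (meson split_list)
    have "distinct (map abs (us @ vs))" "N \<notin> abs ` set (us @ vs)"
      "insert N (abs ` set (us @ vs)) = {1..int (Suc n)}"
      using v e unfolding signed_words_def split by auto
    moreover from this have "abs ` set (us @ vs) = {1..int (Suc n)} - {N}" by blast
    moreover have "{1..int (Suc n)} - {N} = {1..int n}" by (auto simp: N_def)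
    ultimately have "us @ vs \<in> signed_words n"
      using v split by (simp add: signed_words_def)
    moreover have "length us \<le> n" using v split by (simp add: signed_words_def)
    moreover have "e \<in> {N, - N}" using e by auto
    ultimately have "(us @ vs, length us, e) \<in> ?D" by simp
    then show "v \<in> ?f ` ?D" by (rule rev_image_eqI) (simp add: split)
  qed
qed

lemma sum_signed_words_Suc:
  fixes g :: "int list \<Rightarrow> 'a :: comm_monoid_add"
  shows "(\<Sum>v\<in>signed_words (Suc n). g v) =
    (\<Sum>w\<in>signed_words n. \<Sum>i\<le>n. g (take i w @ int (Suc n) # drop i w)
       + g (take i w @ (- int (Suc n)) # drop i w))"
proof -
  have "(\<Sum>v\<in>signed_words (Suc n). g v) =
      (\<Sum>(w, i, e)\<in>signed_words n \<times> {..n} \<times> {int (Suc n), - int (Suc n)}.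
        g (take i w @ e # drop i w))"
    using sum.reindex_bij_betw[OF bij_betw_insert_largest, of g n]
    by (simp add: case_prod_unfold)
  also have "\<dots> = (\<Sum>w\<in>signed_words n. \<Sum>i\<le>n. \<Sum>e\<in>{int (Suc n), - int (Suc n)}.
        g (take i w @ e # drop i w))"
    by (simp add: sum.cartesian_product' del: of_nat_Suc)
  finally show ?thesis by (simp del: of_nat_Suc)
qed

section \<open>The differential recurrence\<close>

text \<open>
  The linear operator that sends \<open>X ^ k\<close> to the sum of \<open>X\<close> to the number of runs over all words
  obtained by inserting a new extreme letter into a word with \<open>n\<close> letters after the initial \<open>0\<close>
  and with \<open>k\<close> runs.
\<close>

definition insertion_op :: "nat \<Rightarrow> int poly \<Rightarrow> int poly" where
  "insertion_op n f = 2 * X * (1 - X^2) * pderiv f + (3 * X - 1 + 2 * of_nat n * X^2) * f"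

lemma pderiv_X: "pderiv X = 1"
  by (simp add: X_def pderiv_pCons)

lemma X_pderiv_X_power: "X * pderiv (X ^ k) = of_nat k * X ^ k"
  by (cases k) (simp_all add: pderiv_power_Suc pderiv_X of_nat_poly del: power_Suc of_nat_Suc,
     simp add: mult_ac)

lemma insertion_op_X_power:
  "insertion_op n (X ^ k) = (2 * of_nat k - 1) * X ^ k + 3 * X ^ (k + 1)
     + 2 * (of_nat n - of_nat k) * X ^ (k + 2)"
proof -
  have "insertion_op n (X ^ k) = 2 * (1 - X^2) * (X * pderiv (X ^ k))
      + (3 * X - 1 + 2 * of_nat n * X^2) * X ^ k"
    by (simp add: insertion_op_def mult_ac)
  then show ?thesis
    unfolding X_pderiv_X_power by (simp add: algebra_simps power2_eq_square)
qed

lemma insertion_op_sum: "insertion_op n (\<Sum>w\<in>S. f w) = (\<Sum>w\<in>S. insertion_op n (f w))"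
  by (simp add: insertion_op_def higher_pderiv_sum[of 1, simplified] sum_distrib_left
      flip: sum.distrib)

definition word_poly :: "nat \<Rightarrow> int poly" where
  "word_poly n = (\<Sum>w\<in>signed_words n. X ^ runs (0 # w))"

lemma word_poly_1: "word_poly 1 = 2 * X"
proof -
  have "signed_words 0 = {[]}" by (auto simp: signed_words_def)
  then show ?thesis
    using sum_signed_words_Suc[of "\<lambda>w. X ^ runs (0 # w)" 0] by (simp add: word_poly_def)
qed

lemma word_poly_Suc:
  assumes "n \<ge> 1"
  shows "word_poly (Suc n) = insertion_op n (word_poly n)"
  unfolding word_poly_def sum_signed_words_Suc insertion_op_sum
proof (rule sum.cong[OF refl])
  fix w assume w: "w \<in> signed_words n"
  then obtain b u where bu: "w = b # u"
    using assms by (cases w) (auto simp: signed_words_def)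
  have small: "\<bar>c\<bar> < int (Suc n)" if "c \<in> set (0 # w)" for c
  proof (cases "c = 0")
    case False
    with that w have "\<bar>c\<bar> \<in> {1..int n}" unfolding signed_words_def by auto
    then show ?thesis by simp
  qed simp
  have len: "length w = n" using w by (simp add: signed_words_def)
  show "(\<Sum>i\<le>n. X ^ runs (0 # take i w @ int (Suc n) # drop i w)
       + X ^ runs (0 # take i w @ (- int (Suc n)) # drop i w)) = insertion_op n (X ^ runs (0 # w))"
    using sum_runs_insertions[of 0 b u "int (Suc n)" X, folded bu,
        OF ballI[OF small] distinct_Cons_0_signed_word[OF w]]
    by (simp only: len insertion_op_X_power Let_def)
qed

section \<open>Alternating runs and turning points\<close>

lemma monotonic_subword_subset:
  assumes "monotonic_subword f c d" "c \<le> a" "b \<le> d"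
  shows "monotonic_subword f a b"
  using assms unfolding monotonic_subword_def
  by (meson atLeastatMost_subset_iff monotone_on_subset)

lemma monotonic_subword_not_turning:
  assumes "monotonic_subword f c d" "inj_on f {c..d}" "c < a" "a < d"
  shows "(f (a - 1) < f a) = (f a < f (a + 1))"
proof -
  have "f (a - 1) \<noteq> f a" "f a \<noteq> f (a + 1)"
    using assms(3,4) inj_on_eq_iff[OF assms(2)] by auto
  moreover have "f (a - 1) \<le> f a \<and> f a \<le> f (a + 1) \<or> f (a - 1) \<ge> f a \<and> f a \<ge> f (a + 1)"
    using assms(1,3,4) unfolding monotonic_subword_def monotone_on_def by force
  ultimately show ?thesis by linarith
qed

text \<open>
  Monotonicity can only fail at the new left end, where it is decided by the two steps around \<open>a\<close>.
\<close>

lemma monotonic_subword_extend_left: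
  assumes mono: "monotonic_subword f a b" and "inj_on f {a - 1..b}" and "a < b"
    and step: "(f (a - 1) < f a) = (f a < f (a + 1))"
  shows "monotonic_subword f (a - 1) b"
proof -
  have neq: "f (a - 1) \<noteq> f a" "f a \<noteq> f (a + 1)"
    using \<open>a < b\<close> inj_on_eq_iff[OF assms(2)] by auto
  have split: "r = a - 1 \<or> r \<in> {a..b}" if "r \<in> {a - 1..b}" for r using that by auto
  from mono consider (up) "mono_on {a..b} f" | (down) "antimono_on {a..b} f"
    unfolding monotonic_subword_def by blast
  then show ?thesis
  proof cases
    case up
    then have le: "f r \<le> f s" if "r \<in> {a..b}" "s \<in> {a..b}" "r \<le> s" for r s
      using that by (auto simp: monotone_on_def)
    from le[of a "a + 1"] \<open>a < b\<close> neq step have "f (a - 1) < f a" by simp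
    moreover have "f a \<le> f s" if "s \<in> {a..b}" for s using that \<open>a < b\<close> le[of a s] by simp
    ultimately have "mono_on {a - 1..b} f"
      using le by (intro monotone_onI) (smt (verit) split atLeastAtMost_iff)
    then show ?thesis by (simp add: monotonic_subword_def)
  next
    case down
    then have le: "f r \<ge> f s" if "r \<in> {a..b}" "s \<in> {a..b}" "r \<le> s" for r s
      using that by (auto simp: monotone_on_def)
    from le[of a "a + 1"] \<open>a < b\<close> neq step have "f (a - 1) > f a" by simp
    moreover have "f a \<ge> f s" if "s \<in> {a..b}" for s using that \<open>a < b\<close> le[of a s] by simp
    ultimately have "antimono_on {a - 1..b} f"
      using le by (intro monotone_onI) (smt (verit) split atLeastAtMost_iff)
    then show ?thesis by (simp add: monotonic_subword_def)
  qed
qed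

text \<open>
  Maximality makes a run determined by its first position, and prevents a run from starting at a
  position which is neither \<open>0\<close> nor a turning point. Conversely, the longest monotonic stretch
  from a turning point cannot be extended to the left, so it is a run.
\<close>

lemma bij_betw_alternating_runs_starts:
  assumes inj: "inj_on f {0..int n}"
  shows "bij_betw fst (alternating_runs n f)
    {a. 0 \<le> a \<and> a < int n \<and> (a = 0 \<or> (f (a - 1) < f a) \<noteq> (f a < f (a + 1)))}"
proof (rule bij_betw_imageI)
  have run: "0 \<le> a \<and> a < b \<and> b \<le> int n \<and> monotonic_subword f a b"
    and maximal: "\<And>c d. 0 \<le> c \<Longrightarrow> c \<le> a \<Longrightarrow> b \<le> d \<Longrightarrow> d \<le> int n
      \<Longrightarrow> monotonic_subword f c d \<Longrightarrow> c = a \<and> d = b"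
    if "(a, b) \<in> alternating_runs n f" for a b
    using that unfolding alternating_runs_def by blast+
  have inj': "inj_on f {a..b}" if "0 \<le> a" "b \<le> int n" for a b
    using inj by (rule inj_on_subset) (use that in auto)
  show "inj_on fst (alternating_runs n f)"
  proof (rule inj_onI, clarsimp)
    fix a b b' assume r: "(a, b) \<in> alternating_runs n f" "(a, b') \<in> alternating_runs n f"
    show "b = b'"
      using maximal[OF r(1), of a b'] maximal[OF r(2), of a b] run[OF r(1)] run[OF r(2)] by force
  qed
  show "fst ` alternating_runs n f =
      {a. 0 \<le> a \<and> a < int n \<and> (a = 0 \<or> (f (a - 1) < f a) \<noteq> (f a < f (a + 1)))}"
  proof (intro equalityI subsetI)
    fix a assume "a \<in> fst ` alternating_runs n f"
    then obtain b where ab: "(a, b) \<in> alternating_runs n f" by force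
    have "(f (a - 1) < f a) \<noteq> (f a < f (a + 1))" if "a \<noteq> 0"
    proof
      assume "(f (a - 1) < f a) = (f a < f (a + 1))"
      then have "monotonic_subword f (a - 1) b"
        using run[OF ab] that by (intro monotonic_subword_extend_left inj') auto
      then show False using maximal[OF ab, of "a - 1" b] run[OF ab] that by simp
    qed
    then show "a \<in> {a. 0 \<le> a \<and> a < int n \<and> (a = 0 \<or> (f (a - 1) < f a) \<noteq> (f a < f (a + 1)))}"
      using run[OF ab] by auto
  next
    fix a assume "a \<in> {a. 0 \<le> a \<and> a < int n \<and> (a = 0 \<or> (f (a - 1) < f a) \<noteq> (f a < f (a + 1)))}"
    then have a: "0 \<le> a" "a < int n" and turn: "a = 0 \<or> (f (a - 1) < f a) \<noteq> (f a < f (a + 1))"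
      by auto
    define S where "S = {b. a < b \<and> b \<le> int n \<and> monotonic_subword f a b}"
    have "finite S" by (rule finite_subset[of _ "{a..int n}"]) (auto simp: S_def)
    have two: "r = a \<or> r = a + 1" if "r \<in> {a..a + 1}" for r using that by auto
    have "monotonic_subword f a (a + 1)"
    proof (cases "f a \<le> f (a + 1)")
      case True
      then have "mono_on {a..a + 1} f" by (intro monotone_onI) (drule two, drule two, auto)
      then show ?thesis by (simp add: monotonic_subword_def)
    next
      case False
      then have "antimono_on {a..a + 1} f" by (intro monotone_onI) (drule two, drule two, auto)
      then show ?thesis by (simp add: monotonic_subword_def)
    qed
    then have "S \<noteq> {}" using a by (auto simp: S_def intro!: exI[of _ "a + 1"])
    define b where "b = Max S"
    have "b \<in> S" unfolding b_def using \<open>finite S\<close> \<open>S \<noteq> {}\<close> by (rule Max_in)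
    then have b: "a < b" "b \<le> int n" "monotonic_subword f a b" by (auto simp: S_def)
    have "c = a \<and> d = b" if cd: "0 \<le> c" "c \<le> a" "b \<le> d" "d \<le> int n" "monotonic_subword f c d"
      for c d
    proof
      show "c = a"
      proof (rule ccontr)
        assume "c \<noteq> a"
        then have "(f (a - 1) < f a) = (f a < f (a + 1))"
          using cd b by (intro monotonic_subword_not_turning[of f c d] inj') auto
        then show False using turn \<open>c \<noteq> a\<close> cd by auto
      qed
      have "d \<in> S" using cd b monotonic_subword_subset[OF cd(5), of a d] by (simp add: S_def)
      then have "d \<le> b" unfolding b_def using \<open>finite S\<close> by simp
      then show "d = b" using cd by simp
    qed
    then have "(a, b) \<in> alternating_runs n f"
      unfolding alternating_runs_def using a b by blast
    then show "a \<in> fst ` alternating_runs n f" by force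
  qed
qed

lemma runs_map_upt:
  "runs (map g [0..<Suc n]) =
     (\<Sum>i<n. of_bool (i = 0 \<or> (g (i - 1) < g i) \<noteq> (g i < g (Suc i))))"
proof (induction n arbitrary: g)
  case (Suc n)
  have shift: "map g [0..<Suc k] = g 0 # map (g \<circ> Suc) [0..<k]" for g :: "nat \<Rightarrow> int" and k
    by (simp add: upt_conv_Cons map_Suc_upt[symmetric] del: upt_Suc)
  show ?case
  proof (cases n)
    case 0
    then show ?thesis by simp
  next
    case (Suc m)
    have "runs (map g [0..<Suc (Suc (Suc m))]) =
        of_bool ((g 0 < g 1) \<noteq> (g 1 < g 2)) + runs (map (g \<circ> Suc) [0..<Suc (Suc m)])"
      unfolding shift by (simp add: numeral_2_eq_2)
    also have "runs (map (g \<circ> Suc) [0..<Suc (Suc m)]) = (\<Sum>i<Suc m. of_bool (i = 0 \<or>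
        ((g \<circ> Suc) (i - 1) < (g \<circ> Suc) i) \<noteq> ((g \<circ> Suc) i < (g \<circ> Suc) (Suc i))))"
      using Suc.IH unfolding \<open>n = Suc m\<close> .
    also have "\<dots> = Suc (\<Sum>i<m. of_bool ((g (Suc i) < g (Suc (Suc i)))
        \<noteq> (g (Suc (Suc i)) < g (Suc (Suc (Suc i))))))"
      unfolding sum.lessThan_Suc_shift by simp
    finally show ?thesis
      unfolding \<open>n = Suc m\<close> sum.lessThan_Suc_shift by (simp add: numeral_2_eq_2)
  qed
qed simp

lemma card_alternating_runs:
  assumes "inj_on f {0..int n}"
  shows "card (alternating_runs n f) = runs (map (\<lambda>i. f (int i)) [0..<Suc n])"
proof -
  define Q where "Q a \<longleftrightarrow> a = 0 \<or> (f (a - 1) < f a) \<noteq> (f a < f (a + 1))" for a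
  have "card (alternating_runs n f) = card {a. 0 \<le> a \<and> a < int n \<and> Q a}"
    unfolding Q_def using bij_betw_alternating_runs_starts[OF assms] by (rule bij_betw_same_card)
  also have "{a. 0 \<le> a \<and> a < int n \<and> Q a} = int ` {i \<in> {..<n}. Q (int i)}"
    by (auto dest!: zero_le_imp_eq_int)
  also have "card \<dots> = card {i \<in> {..<n}. Q (int i)}"
    by (intro card_image) simp
  also have "\<dots> = (\<Sum>i<n. of_bool (Q (int i)))"
    by (simp add: Int_def)
  also have "\<dots> = runs (map (\<lambda>i. f (int i)) [0..<Suc n])"
    unfolding runs_map_upt
    by (intro sum.cong refl) (auto simp: Q_def of_nat_diff Suc_leI add.commute)
  finally show ?thesis .
qed

section \<open>Signed permutations as signed words\<close>

definition word :: "nat \<Rightarrow> (int \<Rightarrow> int) \<Rightarrow> int list" where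
  "word n \<pi> = map (\<lambda>i. \<pi> (int i)) [1..<Suc n]"

lemma signed_perm_0:
  assumes "\<pi> \<in> signed_perms n" shows "\<pi> 0 = 0"
  using assms by (simp add: signed_perms_def permutes_def)

lemma card_alternating_runs_signed_perm:
  assumes "\<pi> \<in> signed_perms n"
  shows "card (alternating_runs n \<pi>) = runs (0 # word n \<pi>)"
proof -
  have "inj \<pi>" using assms permutes_inj by (auto simp: signed_perms_def)
  then have "inj_on \<pi> {0..int n}" by (rule inj_on_subset) simp
  moreover have "[0..<Suc n] = 0 # [1..<Suc n]" by (simp add: upt_rec)
  ultimately show ?thesis
    by (simp add: card_alternating_runs word_def signed_perm_0[OF assms] del: upt_Suc)
qed

lemma bij_betw_word: "bij_betw (word n) (signed_perms n) (signed_words n)"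
proof (rule bij_betw_imageI)
  let ?S = "{- int n..int n} - {0}"
  show "inj_on (word n) (signed_perms n)"
  proof (rule inj_onI, rule ext)
    fix \<pi> \<sigma> i
    assume \<pi>: "\<pi> \<in> signed_perms n" and \<sigma>: "\<sigma> \<in> signed_perms n" and eq: "word n \<pi> = word n \<sigma>"
    have pos: "\<pi> j = \<sigma> j" if "1 \<le> j" "j \<le> int n" for j
    proof -
      have "nat j \<in> set [1..<Suc n]" using that by auto
      with eq have "\<pi> (int (nat j)) = \<sigma> (int (nat j))"
        unfolding word_def map_eq_conv by blast
      with that show ?thesis by simp
    qed
    have odd: "\<pi> (- j) = - \<pi> j" "\<sigma> (- j) = - \<sigma> j" for j
      using \<pi> \<sigma> by (auto simp: signed_perms_def)
    show "\<pi> i = \<sigma> i"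
    proof (cases "i \<in> ?S")
      case True
      then consider "1 \<le> i" "i \<le> int n" | "1 \<le> - i" "- i \<le> int n" by fastforce
      then show ?thesis
      proof cases
        case 2
        then show ?thesis using pos[of "- i"] odd[of i] by simp
      qed (rule pos)
    next
      case False
      then show ?thesis using \<pi> \<sigma> by (simp add: signed_perms_def permutes_def)
    qed
  qed
  show "word n ` signed_perms n = signed_words n"
  proof (intro equalityI subsetI)
    fix w assume "w \<in> word n ` signed_perms n"
    then obtain \<pi> where \<pi>: "\<pi> permutes ?S" "\<And>i. \<pi> (- i) = - \<pi> i" and w: "w = word n \<pi>"
      by (auto simp: signed_perms_def)
    have abs_inj: "i = j" if "\<bar>\<pi> (int i)\<bar> = \<bar>\<pi> (int j)\<bar>" for i j :: nat
    proof -
      from that have "\<pi> (int i) = \<pi> (int j) \<or> \<pi> (int i) = \<pi> (- int j)"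
        using \<pi>(2) by (auto simp: abs_eq_iff)
      then show ?thesis using inj_eq[OF permutes_inj[OF \<pi>(1)]] by auto
    qed
    have dist: "distinct (map abs w)"
      unfolding w word_def by (auto simp: distinct_map inj_on_def dest: abs_inj)
    have "abs ` set w \<subseteq> {1..int n}"
    proof
      fix y assume "y \<in> abs ` set w"
      then obtain i where i: "1 \<le> i" "i \<le> n" and y: "y = \<bar>\<pi> (int i)\<bar>"
        unfolding w word_def by auto
      have "\<pi> (int i) \<in> ?S" using permutes_in_image[OF \<pi>(1), of "int i"] i by simp
      then show "y \<in> {1..int n}" unfolding y by auto
    qed
    moreover have "card (abs ` set w) = n"
      using distinct_card[OF dist] by (simp only: set_map length_map) (simp add: w word_def)
    ultimately have "abs ` set w = {1..int n}" by (intro card_subset_eq) auto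
    with dist show "w \<in> signed_words n" by (simp add: signed_words_def w word_def)
  next
    fix w assume w: "w \<in> signed_words n"
    \<comment> \<open>The odd extension of the word, which is the identity beyond n.\<close>
    define \<pi> where "\<pi> i = (if i \<in> ?S then sgn i * w ! (nat \<bar>i\<bar> - 1) else i)" for i
    have len: "length w = n" and dist: "distinct (map abs w)" and set: "abs ` set w = {1..int n}"
      using w by (auto simp: signed_words_def)
    have idx: "nat \<bar>i\<bar> - 1 < n" if "i \<in> ?S" for i using that by auto
    have letter: "\<bar>w ! (nat \<bar>i\<bar> - 1)\<bar> \<in> {1..int n}" if "i \<in> ?S" for i
      unfolding set[symmetric] using idx[OF that] len by auto
    have abs_sgn_mult: "\<bar>sgn i * y\<bar> = \<bar>y\<bar>" if "i \<in> ?S" for i y :: int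
      using that by (simp add: abs_mult abs_sgn_eq)
    have "inj_on \<pi> ?S"
    proof (rule inj_onI)
      fix i j assume i: "i \<in> ?S" and j: "j \<in> ?S" and eq: "\<pi> i = \<pi> j"
      then have eq': "sgn i * w ! (nat \<bar>i\<bar> - 1) = sgn j * w ! (nat \<bar>j\<bar> - 1)"
        by (simp add: \<pi>_def)
      then have "\<bar>w ! (nat \<bar>i\<bar> - 1)\<bar> = \<bar>w ! (nat \<bar>j\<bar> - 1)\<bar>"
        using abs_sgn_mult i j by metis
      then have "map abs w ! (nat \<bar>i\<bar> - 1) = map abs w ! (nat \<bar>j\<bar> - 1)"
        using idx[OF i] idx[OF j] len by simp
      then have "nat \<bar>i\<bar> - 1 = nat \<bar>j\<bar> - 1"
        using nth_eq_iff_index_eq[OF dist] idx[OF i] idx[OF j] len by simp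
      moreover from this have "sgn i = sgn j" using eq' letter[OF i] by auto
      ultimately show "i = j" using i j by (auto simp: sgn_if split: if_splits)
    qed
    moreover have "\<pi> ` ?S \<subseteq> ?S"
    proof (rule image_subsetI)
      fix i assume i: "i \<in> ?S"
      have "\<bar>\<pi> i\<bar> \<in> {1..int n}"
        unfolding \<pi>_def if_P[OF i] abs_sgn_mult[OF i] by (rule letter[OF i])
      then show "\<pi> i \<in> ?S" by auto
    qed
    ultimately have "bij_betw \<pi> ?S ?S"
      by (simp add: bij_betw_def endo_inj_surj)
    then have "\<pi> permutes ?S" by (rule bij_imp_permutes) (simp only: \<pi>_def if_False)
    moreover have "\<pi> (- i) = - \<pi> i" for i by (auto simp: \<pi>_def sgn_if)
    ultimately have "\<pi> \<in> signed_perms n" by (simp add: signed_perms_def)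
    moreover have "word n \<pi> = w"
      by (rule nth_equalityI) (auto simp: word_def len \<pi>_def nat_add_distrib simp del: upt_Suc)
    ultimately show "w \<in> word n ` signed_perms n" by blast
  qed
qed

text \<open>
  The polynomial sums over \<open>k\<close> from \<open>1\<close> to \<open>n\<close>; this loses no signed permutation because the
  starts of the runs form a subset of \<open>{0..<n}\<close> that contains \<open>0\<close>.
\<close>

lemma T_poly_eq_sum_up_words:
  assumes "n \<ge> 1"
  shows "T_poly n = (\<Sum>w | w \<in> signed_words n \<and> hd w > 0. X ^ runs (0 # w))"
proof -
  have fin: "finite (up_signed_perms n)"
    using bij_betw_finite[OF bij_betw_word] finite_signed_words
    by (auto simp: up_signed_perms_def)
  have hd_word: "hd (word n \<pi>) = \<pi> 1" for \<pi>
    using assms by (simp add: word_def upt_conv_Cons del: upt_Suc)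
  have range: "card (alternating_runs n \<pi>) \<in> {1..n}" if "\<pi> \<in> signed_perms n" for \<pi>
  proof -
    have "inj_on \<pi> {0..int n}"
      using that permutes_inj inj_on_subset by (fastforce simp: signed_perms_def)
    let ?A = "{a. 0 \<le> a \<and> a < int n \<and> (a = 0 \<or> (\<pi> (a - 1) < \<pi> a) \<noteq> (\<pi> a < \<pi> (a + 1)))}"
    have card: "card (alternating_runs n \<pi>) = card ?A"
      using bij_betw_alternating_runs_starts[OF \<open>inj_on \<pi> {0..int n}\<close>]
      by (rule bij_betw_same_card)
    have sub: "?A \<subseteq> {0..<int n}" by auto
    have "card ?A \<le> n" using card_mono[OF _ sub] by simp
    moreover have "0 \<in> ?A" using assms by simp
    then have "?A \<noteq> {}" by blast
    then have "card ?A > 0" using finite_subset[OF sub] by (simp only: card_gt_0_iff) simp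
    ultimately show ?thesis unfolding card by simp
  qed
  have "T_poly n = (\<Sum>k=1..n. \<Sum>\<pi> | \<pi> \<in> up_signed_perms n \<and> card (alternating_runs n \<pi>) = k.
      X ^ card (alternating_runs n \<pi>))"
    unfolding T_poly_def T_def by (intro sum.cong refl) simp
  also have "\<dots> = (\<Sum>\<pi>\<in>up_signed_perms n. X ^ card (alternating_runs n \<pi>))"
    using fin range by (intro sum.group) (auto simp: up_signed_perms_def)
  also have "\<dots> = (\<Sum>\<pi>\<in>up_signed_perms n. X ^ runs (0 # word n \<pi>))"
    by (intro sum.cong refl) (simp add: up_signed_perms_def card_alternating_runs_signed_perm)
  also have "\<dots> = (\<Sum>w\<in>word n ` up_signed_perms n. X ^ runs (0 # w))"
    using bij_betw_imp_inj_on[OF bij_betw_word, of n]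
    by (intro sum.reindex[symmetric, unfolded o_def])
       (auto simp: up_signed_perms_def intro: inj_on_subset)
  also have "word n ` up_signed_perms n = {w \<in> signed_words n. hd w > 0}"
    using bij_betw_imp_surj_on[OF bij_betw_word, of n]
    by (auto simp: up_signed_perms_def hd_word image_iff set_eq_iff) (metis hd_word)+
  finally show ?thesis .
qed

lemma word_poly_eq_double_T_poly:
  assumes "n \<ge> 1"
  shows "word_poly n = 2 * T_poly n"
proof -
  let ?U = "{w \<in> signed_words n. hd w > 0}" and ?D = "{w \<in> signed_words n. hd w < 0}"
  have hd_neg: "hd (map uminus w) = - hd w" if "w \<in> signed_words n" for w
    using that assms by (cases w) (auto simp: signed_words_def)
  have hd_nz: "hd w \<noteq> 0" if "w \<in> signed_words n" for w
    using distinct_Cons_0_signed_word[OF that] that assms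
    by (cases w) (auto simp: signed_words_def)
  have closed: "map uminus w \<in> signed_words n" if "w \<in> signed_words n" for w
    using that by (auto simp: signed_words_def image_image o_def)
  have "(\<Sum>w\<in>?D. X ^ runs (0 # w)) = (\<Sum>w\<in>?U. X ^ runs (0 # w))"
  proof (rule sum.reindex_bij_witness[of _ "map uminus" "map uminus"])
    fix w assume "w \<in> ?D"
    then show "X ^ runs (0 # map uminus w) = X ^ runs (0 # w)"
      using runs_map_uminus[OF distinct_Cons_0_signed_word, of w n] by simp
  qed (auto simp: hd_neg closed o_def)
  moreover have "word_poly n = (\<Sum>w\<in>?U. X ^ runs (0 # w)) + (\<Sum>w\<in>?D. X ^ runs (0 # w))"
    unfolding word_poly_def using finite_signed_words hd_nz
    by (subst sum.union_disjoint[symmetric]) (auto intro!: sum.cong simp: neq_iff)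
  ultimately show ?thesis using T_poly_eq_sum_up_words[OF assms] by simp
qed

section \<open>The convolution identity\<close>

text \<open>
  For \<open>n = 0\<close> this reads \<open>t_poly 1 = - (1 + X) * t_poly 0\<close>, so \<open>t_poly 0 = - 1\<close> is the right
  continuation to index \<open>0\<close>.
\<close>

lemma t_poly_Suc:
  "t_poly (Suc n) = (2 * X * of_bool (odd n) - (1 + X)) * t_poly n"
proof (cases "odd n")
  case True
  then obtain k where "n = 2 * k + 1" by (rule oddE)
  then show ?thesis by (simp add: t_poly_def algebra_simps power2_eq_square)
next
  case False
  then obtain k where "n = 2 * k" by auto
  then show ?thesis by (simp add: t_poly_def algebra_simps power2_eq_square)
qed

lemma pderiv_one_minus_X_sq_power:
  "(1 - X^2) * pderiv ((1 - X^2) ^ k) = - (2 * of_nat k * X) * (1 - X^2) ^ k"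
proof (cases k)
  case (Suc m)
  have "pderiv ((1 - X^2) ^ k) = - (2 * of_nat k * X) * (1 - X^2) ^ m"
    unfolding Suc pderiv_power_Suc
    by (simp add: pderiv_diff pderiv_X pderiv_mult power2_eq_square of_nat_poly mult_ac)
  then show ?thesis
    by (simp add: Suc mult_ac)
qed simp

text \<open>
  The operator \<open>f \<mapsto> 2 X (1 - X\<^sup>2) f' + 2 n X\<^sup>2 f\<close> annihilates \<open>(1 - X\<^sup>2) ^ (n / 2)\<close>, which is
  \<open>t_poly n\<close> up to the sign for even \<open>n\<close> and up to a factor \<open>sqrt ((1 + X) / (1 - X))\<close> for odd \<open>n\<close>;
  the logarithmic derivative of this factor accounts for the right-hand side.
\<close>

lemma pderiv_t_poly:
  "2 * X * (1 - X^2) * pderiv (t_poly n) + 2 * of_nat n * X^2 * t_poly n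
     = 2 * X * of_bool (odd n) * t_poly n"
proof (cases "odd n")
  case True
  then obtain k where k: "n = 2 * k + 1" by (rule oddE)
  define u where "u = (1 - X^2) ^ k"
  have u: "(1 - X^2) * pderiv u = - (2 * of_nat k * X) * u"
    unfolding u_def by (rule pderiv_one_minus_X_sq_power)
  have t: "t_poly n = (1 + X) * u" using k by (simp add: t_poly_def u_def)
  have "2 * X * (1 - X^2) * pderiv (t_poly n)
      = 2 * X * (1 + X) * ((1 - X^2) * pderiv u) + 2 * X * (1 - X^2) * u"
    unfolding t by (simp add: pderiv_mult pderiv_add pderiv_X algebra_simps)
  then show ?thesis
    unfolding u t using k by (simp add: algebra_simps power2_eq_square)
next
  case False
  then obtain k where k: "n = 2 * k" by auto
  define u where "u = (1 - X^2) ^ k"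
  have u: "(1 - X^2) * pderiv u = - (2 * of_nat k * X) * u"
    unfolding u_def by (rule pderiv_one_minus_X_sq_power)
  have t: "t_poly n = - u" using k by (simp add: t_poly_def u_def)
  have "2 * X * (1 - X^2) * pderiv (t_poly n) = - 2 * X * ((1 - X^2) * pderiv u)"
    unfolding t by (simp add: pderiv_minus algebra_simps)
  then show ?thesis
    unfolding u t using k by (simp add: algebra_simps power2_eq_square)
qed

text \<open>
  Pascal's rule expresses the next sum \<open>S (Suc n)\<close> through the shifts of both factors. The
  recurrence of \<open>t_poly\<close> and the hypothesis on \<open>F\<close> contribute the operator
  \<open>f \<mapsto> 2 X (1 - X\<^sup>2) f' + 2 n X\<^sup>2 f\<close> applied to each product, by the Leibniz rule. The rest is the
  multiple \<open>- (1 + X) + (X - 1 + 2 X\<^sup>2) = 2 X\<^sup>2 - 2\<close>, because the parity-dependent terms cancel.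
\<close>

lemma convolution_eq_zero:
  fixes F :: "nat \<Rightarrow> int poly"
  assumes F0: "F 0 = X"
    and F_Suc: "\<And>n. F (Suc n) =
      2 * X * (1 - X^2) * pderiv (F n) + (X - 1 + 2 * of_nat (Suc n) * X^2) * F n"
  shows "(\<Sum>k\<le>Suc n. of_nat (Suc n choose k) * (t_poly (Suc n - k) * F k)) = 0"
proof -
  define S where "S n = (\<Sum>k\<le>n. of_nat (n choose k) * (t_poly (n - k) * F k))" for n
  have pascal: "S (Suc n) = (\<Sum>k\<le>n. of_nat (n choose k) *
      (t_poly (Suc (n - k)) * F k + t_poly (n - k) * F (Suc k)))" for n
  proof -
    have "S (Suc n) = t_poly (Suc n) * F 0 +
        (\<Sum>k\<le>n. of_nat (Suc n choose Suc k) * (t_poly (n - k) * F (Suc k)))"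
      unfolding S_def by (subst sum.atMost_Suc_shift) simp
    also have "\<dots> = (\<Sum>k\<le>n. of_nat (n choose k) * (t_poly (n - k) * F (Suc k))) +
        (t_poly (Suc n) * F 0 +
          (\<Sum>k\<le>n. of_nat (n choose Suc k) * (t_poly (n - k) * F (Suc k))))"
      by (simp add: algebra_simps sum.distrib)
    also have "t_poly (Suc n) * F 0 +
          (\<Sum>k\<le>n. of_nat (n choose Suc k) * (t_poly (n - k) * F (Suc k)))
        = (\<Sum>k\<le>Suc n. of_nat (n choose k) * (t_poly (Suc n - k) * F k))"
      by (subst sum.atMost_Suc_shift) simp
    also have "\<dots> = (\<Sum>k\<le>n. of_nat (n choose k) * (t_poly (Suc (n - k)) * F k))"
      by (simp add: Suc_diff_le)
    finally show ?thesis by (simp add: algebra_simps sum.distrib)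
  qed
  have S_Suc: "S (Suc n) = 2 * X * (1 - X^2) * pderiv (S n)
      + (2 * of_nat (Suc n) * X^2 - 2) * S n" for n
  proof -
    have summand: "t_poly (Suc (n - k)) * F k + t_poly (n - k) * F (Suc k) =
        2 * X * (1 - X^2) * pderiv (t_poly (n - k) * F k)
        + (2 * of_nat (Suc n) * X^2 - 2) * (t_poly (n - k) * F k)" if "k \<le> n" for k
    proof -
      obtain m where n: "n = k + m" using le_Suc_ex[OF \<open>k \<le> n\<close>] by blast
      define p where "p = t_poly m"
      define e :: "int poly" where "e = of_bool (odd m)"
      have p: "2 * X * (1 - X^2) * pderiv p = 2 * X * e * p - 2 * of_nat m * X^2 * p"
        using pderiv_t_poly[of m] by (simp add: p_def e_def algebra_simps)
      have "2 * X * (1 - X^2) * pderiv (p * F k) =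
          (2 * X * (1 - X^2) * pderiv p) * F k + p * (2 * X * (1 - X^2) * pderiv (F k))"
        by (simp add: pderiv_mult algebra_simps)
      also have "\<dots> = (2 * X * e * p - 2 * of_nat m * X^2 * p) * F k
          + p * (F (Suc k) - (X - 1 + 2 * of_nat (Suc k) * X^2) * F k)"
        unfolding p by (simp add: F_Suc)
      finally show ?thesis
        using n by (simp add: t_poly_Suc flip: p_def e_def) (simp add: algebra_simps)
    qed
    have "S (Suc n) = (\<Sum>k\<le>n. of_nat (n choose k) *
        (2 * X * (1 - X^2) * pderiv (t_poly (n - k) * F k)
        + (2 * of_nat (Suc n) * X^2 - 2) * (t_poly (n - k) * F k)))"
      unfolding pascal by (intro sum.cong refl) (simp only: summand atMost_iff)
    also have "\<dots> = 2 * X * (1 - X^2) *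
          (\<Sum>k\<le>n. of_nat (n choose k) * pderiv (t_poly (n - k) * F k))
        + (2 * of_nat (Suc n) * X^2 - 2) * S n"
      unfolding S_def sum_distrib_left sum.distrib[symmetric]
      by (intro sum.cong refl) (simp add: algebra_simps)
    also have "(\<Sum>k\<le>n. of_nat (n choose k) * pderiv (t_poly (n - k) * F k)) = pderiv (S n)"
      unfolding S_def
      by (simp add: higher_pderiv_sum[of 1, simplified] pderiv_mult[of "of_nat _"])
    finally show ?thesis .
  qed
  have "S (Suc n) = 0"
  proof (induction n)
    case 0
    then show ?case
      by (simp add: S_def F0 F_Suc t_poly_def pderiv_X algebra_simps power2_eq_square)
  next
    case (Suc n)
    then show ?case using S_Suc[of "Suc n"] by simp
  qed
  then show ?thesis by (simp add: S_def)
qed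

text \<open>
  The convolution identity for \<open>F k = (1 + X) * T_poly k\<close>, with \<open>F 0 = X\<close>, solved for its top term
  and divided by \<open>1 + X\<close>. The value \<open>F 0 = X\<close> corresponds to \<open>T_poly 0 = X / (1 + X)\<close>, which is the
  origin of the special first column of the matrix.
\<close>

lemma hessenberg_recurrence_of_insertion_op:
  assumes T1: "T_poly 1 = X"
    and T_Suc: "\<And>n. n \<ge> 1 \<Longrightarrow> T_poly (Suc n) = insertion_op n (T_poly n)"
  shows "T_poly (Suc n) = entry (Suc n) 1 + (\<Sum>k=1..n. entry (Suc n) (Suc k) * T_poly k)"
proof -
  define F where "F n = (if n = 0 then X else (1 + X) * T_poly n)" for n
  have "F (Suc n) = 2 * X * (1 - X^2) * pderiv (F n)
      + (X - 1 + 2 * of_nat (Suc n) * X^2) * F n" for n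
  proof (cases "n = 0")
    case True
    then show ?thesis
      using T1 by (simp add: F_def pderiv_X algebra_simps power2_eq_square)
  next
    case False
    then show ?thesis
      by (simp add: F_def T_Suc insertion_op_def pderiv_mult pderiv_add pderiv_X
        algebra_simps power2_eq_square)
  qed
  then have "0 = (\<Sum>k\<le>Suc n. of_nat (Suc n choose k) * (t_poly (Suc n - k) * F k))"
    by (intro convolution_eq_zero[symmetric]) (simp_all add: F_def)
  \<comment> \<open>The summand for k = Suc n carries the factor t_poly 0 = - 1.\<close>
  also have "\<dots> = t_poly (Suc n) * X
      + (\<Sum>k=1..n. of_nat (Suc n choose k) * (t_poly (Suc n - k) * F k)) - F (Suc n)"
    by (simp add: atMost_atLeast0 sum.atLeast_Suc_atMost[of 0] F_def t_poly_def[of 0])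
  also have "(\<Sum>k=1..n. of_nat (Suc n choose k) * (t_poly (Suc n - k) * F k))
      = (1 + X) * (\<Sum>k=1..n. entry (Suc n) (Suc k) * T_poly k)"
    unfolding sum_distrib_left
    by (intro sum.cong refl) (simp add: entry_def F_def Suc_diff_le mult_ac)
  finally have "(1 + X) * T_poly (Suc n)
      = (1 + X) * (entry (Suc n) 1 + (\<Sum>k=1..n. entry (Suc n) (Suc k) * T_poly k))"
    using entry_first_column[of "Suc n"]
    by (simp add: distrib_left[of "1 + X"] F_def mult.commute)
  moreover have "1 + X \<noteq> 0" by (simp add: X_def one_pCons)
  ultimately show ?thesis by (metis mult_left_cancel)
qed

section \<open>The determinant\<close>

text \<open>
  The recurrence says that the matrix maps the vector \<open>(v 0, ..., v (n - 1))\<close> to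
  \<open>(0, ..., 0, v n)\<close>. Because \<open>v 0 = 1\<close>, Cramer's rule allows the first column to be replaced by
  this image without changing the determinant; expansion along that column leaves a triangular
  minor with diagonal \<open>- 1\<close>.
\<close>

lemma det_hessenberg:
  fixes a :: "nat \<Rightarrow> nat \<Rightarrow> 'a :: idom" and v :: "nat \<Rightarrow> 'a"
  assumes super: "\<And>i. Suc i < n \<Longrightarrow> a i (Suc i) = - 1"
    and zero: "\<And>i j. Suc i < j \<Longrightarrow> j < n \<Longrightarrow> a i j = 0"
    and v0: "v 0 = 1"
    and rec: "\<And>i. i < n \<Longrightarrow> v (Suc i) = (\<Sum>j\<le>i. a i j * v j)"
    and "n > 0"
  shows "det (mat n n (\<lambda>(i, j). a i j)) = v n"
proof -
  define A where "A = mat n n (\<lambda>(i, j). a i j)"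
  define x where "x = vec n v"
  have A: "A \<in> carrier_mat n n" and x: "x \<in> carrier_vec n"
    by (simp_all add: A_def x_def)
  have Ax: "(A *\<^sub>v x) $ i = (if Suc i = n then v n else 0)" if "i < n" for i
  proof -
    have "(A *\<^sub>v x) $ i = (\<Sum>j<n. a i j * v j)"
      using that by (simp add: A_def x_def scalar_prod_def lessThan_atLeast0)
    also have "\<dots> = (\<Sum>j\<in>{..i} \<union> ({Suc i} \<inter> {..<n}). a i j * v j)"
      using that by (intro sum.mono_neutral_right) (auto, metis zero Suc_lessI not_le)
    also have "\<dots> = (\<Sum>j\<le>i. a i j * v j) + (\<Sum>j\<in>{Suc i} \<inter> {..<n}. a i j * v j)"
      by (intro sum.union_disjoint) auto
    also have "\<dots> = (if Suc i = n then v n else 0)"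
    proof (cases "Suc i = n")
      case True
      then show ?thesis using rec[OF that] by simp
    next
      case False
      with that have "Suc i < n" by simp
      then have "{Suc i} \<inter> {..<n} = {Suc i}" by auto
      with False \<open>Suc i < n\<close> rec[OF that] super[of i] show ?thesis by simp
    qed
    finally show ?thesis .
  qed
  define B where "B = replace_col A (A *\<^sub>v x) 0"
  have B: "B \<in> carrier_mat n n" by (simp add: B_def replace_col_def A_def)
  have B0: "B $$ (i, 0) = (if Suc i = n then v n else 0)" if "i < n" for i
    using that Ax[OF that] \<open>n > 0\<close> A by (simp add: B_def replace_col_def)
  define C where "C = mat_delete B (n - 1) 0"
  have C: "C \<in> carrier_mat (n - 1) (n - 1)"
    using B by (simp add: C_def mat_delete_def)
  have C_entry: "C $$ (i, j) = a i (Suc j)" if "i < n - 1" "j < n - 1" for i j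
    using that B A by (simp add: C_def mat_delete_def B_def replace_col_def A_def)
  have "det A = det B"
    using cramer_lemma_mat[OF A x \<open>n > 0\<close>] \<open>n > 0\<close> v0 by (simp add: B_def x_def)
  also have "\<dots> = (\<Sum>i<n. B $$ (i, 0) * cofactor B i 0)"
    using laplace_expansion_column[OF B \<open>n > 0\<close>] .
  also have "\<dots> = (\<Sum>i<n. if i = n - 1 then v n * cofactor B i 0 else 0)"
    by (intro sum.cong) (auto simp: B0)
  also have "\<dots> = v n * ((- 1) ^ (n - 1) * det C)"
    using \<open>n > 0\<close> by (simp add: cofactor_def C_def)
  also have "det C = prod_list (diag_mat C)"
    by (rule det_lower_triangular[OF _ C]) (use C_entry zero in auto)
  also have "diag_mat C = replicate (n - 1) (- 1)"
    using C C_entry super by (intro nth_equalityI) (auto simp: diag_mat_def)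
  also have "v n * ((- 1) ^ (n - 1) * prod_list (replicate (n - 1) (- 1))) = v n"
    by (simp flip: power_mult_distrib)
  finally show ?thesis by (simp add: A_def)
qed

theorem theorem16:
  fixes n :: nat
  assumes "n \<ge> 1"
  shows "T_poly n = det (hessenberg_mat n)"
proof -
  have "2 * T_poly 1 = 2 * X" using word_poly_1 word_poly_eq_double_T_poly[of 1] by simp
  then have T1: "T_poly 1 = X" by simp
  have "2 * T_poly (Suc m) = 2 * insertion_op m (T_poly m)" if "m \<ge> 1" for m
    using word_poly_Suc[OF that] word_poly_eq_double_T_poly[OF that]
      word_poly_eq_double_T_poly[of "Suc m"]
    by (simp add: insertion_op_def pderiv_mult algebra_simps)
  then have T_Suc: "T_poly (Suc m) = insertion_op m (T_poly m)" if "m \<ge> 1" for m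
    using that by simp
  let ?v = "\<lambda>m. if m = 0 then 1 else T_poly m"
  have "det (mat n n (\<lambda>(i, j). entry (i + 1) (j + 1))) = ?v n"
  proof (rule det_hessenberg)
    fix i
    have "(\<Sum>j\<le>i. entry (i + 1) (j + 1) * ?v j)
        = entry (Suc i) 1 + (\<Sum>j=1..i. entry (Suc i) (Suc j) * T_poly j)"
      by (simp add: atMost_atLeast0 sum.atLeast_Suc_atMost[of 0])
    then show "?v (Suc i) = (\<Sum>j\<le>i. entry (i + 1) (j + 1) * ?v j)"
      using hessenberg_recurrence_of_insertion_op[OF T1 T_Suc, of i] by simp
  qed (use assms in \<open>auto simp: entry_def\<close>)
  then show ?thesis using assms by (simp add: hessenberg_mat_def)
qed

end
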